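(* Let $X$ be an observable with values $x$, let $\theta\in\mathbb{R}^d$ be the parameter to be estimated (i.e. $\gamma(\theta)=\theta$), and let $\pi$ be a prior. Suppose that the posterior density for $\theta$ is, for all $x$, location invariant of the form $\theta|x\sim f(\theta-\mu(x))$, where $f$ does not depend on $x$ and $\mu(x)\in\mathbb{R}^d$, and that the first-stage loss for estimating $\theta$ is location invariant, i.e. of the form $L(\theta,\hat\theta)=\beta(\hat\theta-\theta)$ with $\beta:\mathbb{R}^d\to\mathbb{R}_+$. Then: (a) the Bayes estimator $\hat\theta_\pi(X)$, whenever it exists, is of the form $\hat\theta_\pi(x)=\mu(x)+k$, $k$ being a constant (not depending on $x$); (b) the posterior distribution of the loss $\beta(\hat\theta_\pi(x)-\theta)$ is free of $x$ (does not depend on $x$); (c) the Bayes estimator $\hat L_\pi(x)$ of the loss $\beta(\hat\theta_\pi(x)-\theta)$ with respect to second-stage loss $W(L,\hat L)$ is, whenever it exists, free of $x$.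
   Context: $\mathbb{R}_+$ denotes the nonnegative reals. All posterior quantities are with respect to the (possibly improper) prior $\pi$. A Bayes estimator $\hat\theta_\pi(x)$ of $\theta$ under first-stage loss $L(\theta,\hat\theta)$ minimizes in $\hat\theta$ the expected posterior loss $\mathbb{E}(L(\theta,\hat\theta)|x)$. A second-stage loss is a function $W(L,\hat L)\in[0,\infty)$ used for estimating the loss value $L=L(\theta,\hat\theta_\pi(x))$ by $\hat L$. A Bayes estimator $\hat L_\pi(x)$ of $L$ minimizes in $\hat L$ the expected posterior loss $\mathbb{E}(W(L,\hat L)|x)$, where the expectation is with respect to the posterior distribution of $\theta$ given $x$. *)

theory Defs
  imports "HOL-Probability.Probability"
begin

text \<open>
  \<open>Q\<close> is a posterior for the sampling model \<open>P\<close> (a Markov kernel from the parameter space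
  to the sample space \<open>M\<close>) under the possibly improper prior \<open>pr\<close>: the joint measure
  \<open>P \<theta> (dx) pr (d\<theta>)\<close> disintegrates as \<open>Q x (d\<theta>) m (dx)\<close>, where \<open>m = pr \<bind> P\<close> is the
  (possibly infinite) marginal measure of the observable. For a dominated model with finite
  marginal density, Bayes' formula yields such a \<open>Q\<close>.
\<close>

definition is_posterior ::
  "'x measure \<Rightarrow> 't measure \<Rightarrow> ('t \<Rightarrow> 'x measure) \<Rightarrow> ('x \<Rightarrow> 't measure) \<Rightarrow> bool" where
  "is_posterior M pr P Q \<longleftrightarrow>
     Q \<in> M \<rightarrow>\<^sub>M prob_algebra pr \<and>
     (\<forall>A\<in>sets M. \<forall>B\<in>sets pr.
        (\<integral>\<^sup>+\<theta>. emeasure (P \<theta>) A * indicator B \<theta> \<partial>pr)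
          = (\<integral>\<^sup>+x. emeasure (Q x) B * indicator A x \<partial>(pr \<bind> P)))"

text \<open>
  Expected losses are nonnegative Lebesgue integrals, so that a non-integrable loss has
  expectation \<open>\<infinity>\<close>; the Bochner integral would give it the value 0.
\<close>

definition posterior_expected_loss :: "'t measure \<Rightarrow> ('t \<Rightarrow> 'a \<Rightarrow> real) \<Rightarrow> 'a \<Rightarrow> ennreal" where
  "posterior_expected_loss q loss a = (\<integral>\<^sup>+\<theta>. ennreal (loss \<theta> a) \<partial>q)"

definition bayes_acts :: "'t measure \<Rightarrow> ('t \<Rightarrow> 'a \<Rightarrow> real) \<Rightarrow> 'a set \<Rightarrow> 'a set" where
  "bayes_acts q loss D = {a. is_arg_min (posterior_expected_loss q loss) (\<lambda>b. b \<in> D) a}"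

text \<open>
  \<open>\<delta>\<close> is \<^emph>\<open>the\<close> Bayes estimator: at every \<open>x\<close>, \<open>\<delta> x\<close> is the unique minimizer of the
  posterior expected loss. The loss may depend on \<open>x\<close>, as it does when the estimated quantity is
  itself the loss incurred by an estimator.
\<close>

definition the_bayes_estimator ::
  "'x measure \<Rightarrow> ('x \<Rightarrow> 't measure) \<Rightarrow> ('x \<Rightarrow> 't \<Rightarrow> 'a \<Rightarrow> real) \<Rightarrow> 'a set \<Rightarrow> ('x \<Rightarrow> 'a) \<Rightarrow> bool" where
  "the_bayes_estimator M Q loss D \<delta> \<longleftrightarrow> (\<forall>x\<in>space M. bayes_acts (Q x) (loss x) D = {\<delta> x})"

end

theory Submission
  imports Defs
begin

text \<open>
  Everything takes place at a single reference measure: with \<open>q\<^sub>0\<close> the measure with Lebesgue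
  density \<open>f\<close>, translation invariance of Lebesgue measure makes the posterior at \<open>x\<close> the image
  of \<open>q\<^sub>0\<close> under \<open>u \<mapsto> \<mu> x + u\<close> (lemma \<open>density_lborel_translate\<close>). Minimization over actions
  commutes with image measures (lemma \<open>bayes_acts_distr\<close>), so a decision problem at \<open>x\<close> may be
  solved under \<open>q\<^sub>0\<close> after replacing \<open>\<theta>\<close> by \<open>\<mu> x + u\<close> in the loss.

  For the first stage, \<open>\<beta> (a - (\<mu> x + u)) = \<beta> ((a - \<mu> x) - u)\<close>: the problem at \<open>x\<close> is the
  reference problem with the action translated by \<open>\<mu> x\<close>, so its set of minimizers is \<open>\<mu> x + K\<close>,
  where \<open>K\<close> is the set of reference minimizers. For the second stage, the estimate \<open>\<mu> x + k\<close> incurs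
  the loss \<open>\<beta> ((\<mu> x + k) - (\<mu> x + u)) = \<beta> (k - u)\<close>, from which \<open>x\<close> has vanished. Hence neither the
  law of that loss nor the minimizers of any loss built on it depend on \<open>x\<close>.

  If a unique Bayes estimator exists and the sample space is nonempty, \<open>K\<close> is a singleton, and the
  claims on estimators are those on sets of minimizers.
\<close>

text \<open>
  Lebesgue measure is its own image under \<open>u \<mapsto> m + u\<close>, and a density with respect to an image
  measure pulls back along the map; here \<open>f ((m + u) - m)\<close> is \<open>f u\<close>.
\<close>

lemma density_lborel_translate:
  fixes f :: "'a :: euclidean_space \<Rightarrow> ennreal"
  assumes [measurable]: "f \<in> borel_measurable borel"
  shows "density lborel (\<lambda>\<theta>. f (\<theta> - m)) = distr (density lborel f) borel ((+) m)"
proof -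
  have "density (distr lborel borel ((+) m)) (\<lambda>\<theta>. f (\<theta> - m)) = distr (density lborel f) borel ((+) m)"
    by (subst density_distr) auto
  then show ?thesis
    by (simp add: lborel_distr_plus)
qed

lemma bayes_acts_cong:
  assumes "\<And>a. a \<in> D \<Longrightarrow> posterior_expected_loss q loss a = posterior_expected_loss q' loss' a"
  shows "bayes_acts q loss D = bayes_acts q' loss' D"
  using assms by (auto simp: bayes_acts_def is_arg_min_def)

text \<open>
  Changing variables in the posterior expected loss leaves the objective unchanged at every
  admissible action, so the minimizers agree. This is how all dependence on the posterior's
  location is moved from the measure into the loss.
\<close>

lemma bayes_acts_distr:
  assumes [measurable]: "T \<in> q \<rightarrow>\<^sub>M N"
    and "\<And>a. a \<in> D \<Longrightarrow> (\<lambda>\<theta>. ennreal (loss \<theta> a)) \<in> borel_measurable N"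
  shows "bayes_acts (distr q N T) loss D = bayes_acts q (\<lambda>u. loss (T u)) D"
  using assms(2) by (intro bayes_acts_cong) (simp add: posterior_expected_loss_def nn_integral_distr)

lemma bayes_acts_translate_action:
  fixes loss :: "'t \<Rightarrow> 'a :: ab_group_add \<Rightarrow> real"
  shows "bayes_acts q (\<lambda>\<theta> a. loss \<theta> (a - m)) UNIV = (\<lambda>k. m + k) ` bayes_acts q loss UNIV"
proof -
  have shift: "posterior_expected_loss q (\<lambda>\<theta> a. loss \<theta> (a - m)) a
      = posterior_expected_loss q loss (a - m)" for a
    by (simp add: posterior_expected_loss_def)
  have "a \<in> bayes_acts q (\<lambda>\<theta> a. loss \<theta> (a - m)) UNIV \<longleftrightarrow> a - m \<in> bayes_acts q loss UNIV" for a
  proof -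
    have "(\<exists>b. posterior_expected_loss q loss (b - m) < c)
        \<longleftrightarrow> (\<exists>b. posterior_expected_loss q loss b < c)" for c
      by (metis add_diff_cancel_right')
    then show ?thesis
      by (simp add: bayes_acts_def is_arg_min_def shift)
  qed
  then show ?thesis
    by (force simp: image_iff algebra_simps)
qed

theorem theorem1:
  fixes M :: "'x measure"
    and pr :: "(real ^ 'd) measure"
    and P :: "real ^ 'd \<Rightarrow> 'x measure"
    and Q :: "'x \<Rightarrow> (real ^ 'd) measure"
    and f :: "real ^ 'd \<Rightarrow> real"
    and \<mu> :: "'x \<Rightarrow> real ^ 'd"
    and L :: "real ^ 'd \<Rightarrow> real ^ 'd \<Rightarrow> real"
    and \<beta> :: "real ^ 'd \<Rightarrow> real"
    and W :: "real \<Rightarrow> real \<Rightarrow> real"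
    and D :: "real set"
  assumes prior: "sets pr = sets borel" "sigma_finite_measure pr"
    and model: "P \<in> pr \<rightarrow>\<^sub>M prob_algebra M"
    and posterior: "is_posterior M pr P Q"
    and f: "f \<in> borel_measurable borel" "\<And>u. f u \<ge> 0"
    and posterior_density: "\<And>x. x \<in> space M \<Longrightarrow> Q x = density lborel (\<lambda>\<theta>. ennreal (f (\<theta> - \<mu> x)))"
    and \<beta>: "\<beta> \<in> borel_measurable borel" "\<And>u. \<beta> u \<ge> 0"
    and first_stage: "\<And>\<theta> t. L \<theta> t = \<beta> (t - \<theta>)"
    and second_stage: "\<And>a. a \<in> D \<Longrightarrow> (\<lambda>l. W l a) \<in> borel_measurable (restrict_space borel {0..})"
      "\<And>l a. l \<ge> 0 \<Longrightarrow> a \<in> D \<Longrightarrow> W l a \<ge> 0"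
  shows
    \<comment> \<open>(a)\<close>
    "(\<forall>\<theta>h. the_bayes_estimator M Q (\<lambda>x. L) UNIV \<theta>h \<longrightarrow>
        (\<exists>k. \<forall>x\<in>space M. \<theta>h x = \<mu> x + k)) \<and>
     \<comment> \<open>(b)\<close>
     (\<forall>\<theta>h. the_bayes_estimator M Q (\<lambda>x. L) UNIV \<theta>h \<longrightarrow>
        (\<exists>\<nu>. \<forall>x\<in>space M. distr (Q x) borel (\<lambda>\<theta>. \<beta> (\<theta>h x - \<theta>)) = \<nu>)) \<and>
     \<comment> \<open>(c)\<close>
     (\<forall>\<theta>h Lh. the_bayes_estimator M Q (\<lambda>x. L) UNIV \<theta>h \<longrightarrow>
        the_bayes_estimator M Q (\<lambda>x \<theta>. W (\<beta> (\<theta>h x - \<theta>))) D Lh \<longrightarrow>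
        (\<exists>c. \<forall>x\<in>space M. Lh x = c)) \<and>
     \<comment> \<open>the same three claims when minimizers need not exist or be unique\<close>
     (\<exists>K. (\<forall>x\<in>space M. bayes_acts (Q x) L UNIV = (\<lambda>k. \<mu> x + k) ` K) \<and>
        (\<forall>k\<in>K.
           (\<exists>\<nu>. \<forall>x\<in>space M. distr (Q x) borel (\<lambda>\<theta>. \<beta> ((\<mu> x + k) - \<theta>)) = \<nu>) \<and>
           (\<exists>C. \<forall>x\<in>space M. bayes_acts (Q x) (\<lambda>\<theta>. W (\<beta> ((\<mu> x + k) - \<theta>))) D = C)))"
proof -
  define q\<^sub>0 :: "(real ^ 'd) measure" where "q\<^sub>0 = density lborel (\<lambda>u. ennreal (f u))"
  define K where "K = bayes_acts q\<^sub>0 L UNIV"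
  have sets_q\<^sub>0 [measurable_cong]: "sets q\<^sub>0 = sets borel"
    by (simp add: q\<^sub>0_def)
  note [measurable] = f(1) \<beta>(1)
  have Q_eq: "Q x = distr q\<^sub>0 borel ((+) (\<mu> x))" if "x \<in> space M" for x
    unfolding posterior_density[OF that] q\<^sub>0_def by (rule density_lborel_translate) measurable

  have acts: "bayes_acts (Q x) L UNIV = (\<lambda>k. \<mu> x + k) ` K" if "x \<in> space M" for x
  proof -
    have "bayes_acts (Q x) L UNIV = bayes_acts q\<^sub>0 (\<lambda>u. L (\<mu> x + u)) UNIV"
      unfolding Q_eq[OF that] by (rule bayes_acts_distr) (simp_all add: first_stage)
    also have "(\<lambda>u. L (\<mu> x + u)) = (\<lambda>u a. L u (a - \<mu> x))"
      by (simp add: first_stage fun_eq_iff algebra_simps)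
    finally show ?thesis
      by (simp add: bayes_acts_translate_action K_def)
  qed

  have law: "distr (Q x) borel (\<lambda>\<theta>. \<beta> ((\<mu> x + k) - \<theta>)) = distr q\<^sub>0 borel (\<lambda>u. \<beta> (k - u))"
    if "x \<in> space M" for x k
    unfolding Q_eq[OF that] by (subst distr_distr) (simp_all add: comp_def)

  have acts2: "bayes_acts (Q x) (\<lambda>\<theta>. W (\<beta> ((\<mu> x + k) - \<theta>))) D = bayes_acts q\<^sub>0 (\<lambda>u. W (\<beta> (k - u))) D"
    if "x \<in> space M" for x k
  proof -
    \<comment> \<open>The second-stage loss is measurable only on the half-line, where \<open>\<beta>\<close> takes its values.\<close>
    have "(\<lambda>\<theta>. \<beta> ((\<mu> x + k) - \<theta>)) \<in> borel \<rightarrow>\<^sub>M restrict_space borel {0..}"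
      using \<beta>(2) by (intro measurable_restrict_space2) auto
    then have "(\<lambda>\<theta>. W (\<beta> ((\<mu> x + k) - \<theta>)) a) \<in> borel_measurable borel" if "a \<in> D" for a
      using second_stage(1)[OF that] by (rule measurable_compose)
    then have "bayes_acts (Q x) (\<lambda>\<theta>. W (\<beta> ((\<mu> x + k) - \<theta>))) D
        = bayes_acts q\<^sub>0 (\<lambda>u. W (\<beta> ((\<mu> x + k) - (\<mu> x + u)))) D"
      unfolding Q_eq[OF that] by (intro bayes_acts_distr) simp_all
    then show ?thesis
      by simp
  qed

  have a: "\<exists>k. \<forall>x\<in>space M. \<theta>h x = \<mu> x + k" if "the_bayes_estimator M Q (\<lambda>x. L) UNIV \<theta>h" for \<theta>h
  proof -
    have "K = {\<theta>h x - \<mu> x}" if "x \<in> space M" for x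
    proof -
      have "(\<lambda>k. \<mu> x + k) ` K = {\<theta>h x}"
        using \<open>the_bayes_estimator M Q (\<lambda>x. L) UNIV \<theta>h\<close> acts[OF that] that
        by (simp add: the_bayes_estimator_def)
      then have "(\<lambda>b. b - \<mu> x) ` (\<lambda>k. \<mu> x + k) ` K = {\<theta>h x - \<mu> x}"
        by simp
      then show ?thesis
        by (simp add: image_image)
    qed
    then have "\<theta>h x = \<mu> x + the_elem K" if "x \<in> space M" for x
      using that by simp
    then show ?thesis
      by blast
  qed

  have b: "\<exists>\<nu>. \<forall>x\<in>space M. distr (Q x) borel (\<lambda>\<theta>. \<beta> (\<theta>h x - \<theta>)) = \<nu>"
    if est: "the_bayes_estimator M Q (\<lambda>x. L) UNIV \<theta>h" for \<theta>h
  proof -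
    obtain k where "\<And>x. x \<in> space M \<Longrightarrow> \<theta>h x = \<mu> x + k"
      using a[OF est] by blast
    then have "distr (Q x) borel (\<lambda>\<theta>. \<beta> (\<theta>h x - \<theta>)) = distr q\<^sub>0 borel (\<lambda>u. \<beta> (k - u))"
      if "x \<in> space M" for x
      using that law[OF that, of k] by simp
    then show ?thesis
      by blast
  qed

  have c: "\<exists>c. \<forall>x\<in>space M. Lh x = c"
    if est: "the_bayes_estimator M Q (\<lambda>x. L) UNIV \<theta>h"
      and est2: "the_bayes_estimator M Q (\<lambda>x \<theta>. W (\<beta> (\<theta>h x - \<theta>))) D Lh" for \<theta>h Lh
  proof -
    obtain k where k: "\<And>x. x \<in> space M \<Longrightarrow> \<theta>h x = \<mu> x + k"
      using a[OF est] by blast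
    have "bayes_acts q\<^sub>0 (\<lambda>u. W (\<beta> (k - u))) D = {Lh x}" if "x \<in> space M" for x
      using est2 that acts2[OF that, of k] by (simp add: the_bayes_estimator_def k)
    then have "Lh x = the_elem (bayes_acts q\<^sub>0 (\<lambda>u. W (\<beta> (k - u))) D)" if "x \<in> space M" for x
      using that by simp
    then show ?thesis
      by blast
  qed

  show ?thesis
  proof (intro conjI exI[of _ K] ballI allI impI)
    show "\<exists>\<nu>. \<forall>x\<in>space M. distr (Q x) borel (\<lambda>\<theta>. \<beta> ((\<mu> x + k) - \<theta>)) = \<nu>" for k
      using law[of _ k] by (intro exI ballI)
    show "\<exists>C. \<forall>x\<in>space M. bayes_acts (Q x) (\<lambda>\<theta>. W (\<beta> ((\<mu> x + k) - \<theta>))) D = C" for k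
      using acts2[of _ k] by (intro exI ballI)
  qed (fact a b c acts)+
qed

end
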